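(* Let $(B^m,g^H)$ be the $m$-dimensional hyperbolic space in the open-ball model, where $B^m=\{x\in\mathbb{R}^m:|x|<1\}$ and $g^H=F^{-2}\delta_{ij}$ with $F=\frac12(1-|x|^2)$. Then the $\infty$-Laplace equation in the hyperbolic space $(B^m,g^H)$ is the conformal $\infty$-Laplace equation in Euclidean space, which can be written as $$\Delta_\infty^{\mathbb{R}^m}u-\frac{2|\nabla u|^2}{1-|x|^2}\langle x,\nabla u\rangle=0,\qquad x\in B^m.$$ That is, a $C^2$ function $u$ satisfies the $\infty$-Laplace equation with respect to $g^H$ if and only if it satisfies the displayed equation.
   Context: For a $C^2$ function $u$ on a Riemannian manifold $(M,g)$, the $\infty$-Laplace equation is $\frac12 g(\mathrm{grad}\,u,\mathrm{grad}\,|\mathrm{grad}\,u|^2)=0$. In the displayed equation, $|\cdot|$ and $\nabla$ denote the norm and gradient of the Euclidean metric $\langle\cdot,\cdot\rangle$ on $B^m\subset\mathbb{R}^m$, and $\Delta_\infty^{\mathbb{R}^m}u=\frac12\langle\nabla u,\nabla|\nabla u|^2\rangle$ is the Euclidean $\infty$-Laplacian. *)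

theory Defs
  imports "HOL-Analysis.Analysis"
begin

text \<open>A Riemannian metric on an open subset of a Euclidean space is given in the standard global
  chart, where all tangent spaces are identified with the ambient space: \<open>g x v w\<close> is the inner
  product of the tangent vectors \<open>v\<close> and \<open>w\<close> at the point \<open>x\<close>.\<close>

type_synonym 'a metric_field = "'a \<Rightarrow> 'a \<Rightarrow> 'a \<Rightarrow> real"

text \<open>The gradient of \<open>f\<close> at \<open>x\<close> is the vector representing the differential:
  \<open>df\<^sub>x(w) = g\<^sub>x(grad f, w)\<close> for all \<open>w\<close>. It is unspecified where \<open>f\<close> is not differentiable.\<close>

definition gradient ::
    "'a::real_normed_vector metric_field \<Rightarrow> ('a \<Rightarrow> real) \<Rightarrow> 'a \<Rightarrow> 'a" where
  "gradient g f x = (THE D. (f has_derivative g x D) (at x))"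

definition infinity_laplacian ::
    "'a::real_normed_vector metric_field \<Rightarrow> ('a \<Rightarrow> real) \<Rightarrow> 'a \<Rightarrow> real" where
  "infinity_laplacian g u x =
     1 / 2 * g x (gradient g u x)
                 (gradient g (\<lambda>y. g y (gradient g u y) (gradient g u y)) x)"

definition euclidean_metric_field :: "'a::real_inner metric_field" where
  "euclidean_metric_field x v w = v \<bullet> w"

definition hyperbolic_factor :: "'a::real_inner \<Rightarrow> real" where
  "hyperbolic_factor x = 1 / 2 * (1 - (norm x)\<^sup>2)"

text \<open>The tensor \<open>F\<^sup>-\<^sup>2 \<delta>\<^sub>i\<^sub>j\<close>, which is a Riemannian metric on \<open>ball 0 1\<close>.\<close>

definition hyperbolic_metric_field :: "'a::real_inner metric_field" where
  "hyperbolic_metric_field x v w = inverse ((hyperbolic_factor x)\<^sup>2) * (v \<bullet> w)"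

text \<open>Twice continuous differentiability of a real function on an open set \<open>S\<close>. The derivatives
  are taken at points of \<open>S\<close> with respect to the full neighbourhood filter, so that values of \<open>u\<close>
  outside \<open>S\<close> are irrelevant. Continuity of \<open>u\<close> and of \<open>u'\<close> is automatic.\<close>

definition C2_on :: "'a::real_normed_vector set \<Rightarrow> ('a \<Rightarrow> real) \<Rightarrow> bool" where
  "C2_on S u \<longleftrightarrow>
     (\<exists>(u' :: 'a \<Rightarrow> 'a \<Rightarrow>\<^sub>L real) (u'' :: 'a \<Rightarrow> 'a \<Rightarrow>\<^sub>L 'a \<Rightarrow>\<^sub>L real).
        (\<forall>x\<in>S. (u has_derivative blinfun_apply (u' x)) (at x)) \<and>
        (\<forall>x\<in>S. (u' has_derivative blinfun_apply (u'' x)) (at x)) \<and>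
        continuous_on S u'')"

end

theory Submission
  imports Defs
begin

text \<open>Write \<open>\<nabla>\<close> for the Euclidean gradient and consider a conformally flat metric
  \<open>g = F\<^sup>-\<^sup>2 \<delta>\<^sub>i\<^sub>j\<close>. The \<open>g\<close>-gradient of a function is \<open>F\<^sup>2\<close> times its Euclidean gradient, so the
  squared \<open>g\<close>-norm of the \<open>g\<close>-gradient of \<open>u\<close> is \<open>F\<^sup>2 \<bar>\<nabla>u\<bar>\<^sup>2\<close>. Differentiating this product shows
  that the \<open>\<infinity>\<close>-Laplacian of \<open>u\<close> with respect to \<open>g\<close> equals
  \<open>F\<^sup>4 \<Delta>\<^sub>\<infinity>u + F\<^sup>3 \<bar>\<nabla>u\<bar>\<^sup>2 \<langle>\<nabla>F, \<nabla>u\<rangle>\<close>, where \<open>\<Delta>\<^sub>\<infinity>\<close> is the Euclidean \<open>\<infinity>\<close>-Laplacian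
  (lemma \<open>infinity_laplacian_conformal\<close>). For \<open>F = (1 - \<bar>x\<bar>\<^sup>2) / 2\<close> one has \<open>\<nabla>F = -x\<close>, and
  dividing by \<open>F\<^sup>4 > 0\<close> gives the displayed equation, pointwise on the ball.\<close>

lemma gradient_euclidean_eq:
  fixes D :: "'a::real_inner"
  assumes "(f has_derivative (\<lambda>h. D \<bullet> h)) (at x)"
  shows "gradient euclidean_metric_field f x = D"
  unfolding gradient_def euclidean_metric_field_def
proof (rule the_equality)
  show "(f has_derivative (\<bullet>) D) (at x)"
    using assms by simp
next
  fix E assume "(f has_derivative (\<bullet>) E) (at x)"
  then have "(\<bullet>) E = (\<lambda>h. D \<bullet> h)"
    using assms by (rule has_derivative_unique)
  then show "E = D"
    by (metis vector_eq_rdot)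
qed

lemma has_derivative_gradient_euclidean:
  fixes f :: "'a::euclidean_space \<Rightarrow> real"
  assumes "f differentiable at x"
  shows "(f has_derivative (\<lambda>h. gradient euclidean_metric_field f x \<bullet> h)) (at x)"
proof -
  obtain f' where f': "(f has_derivative f') (at x)"
    using assms by (auto simp: differentiable_def)
  \<comment> \<open>the vector representing the linear functional \<open>f'\<close> with respect to the inner product\<close>
  define D where "D = (\<Sum>b\<in>Basis. f' b *\<^sub>R b)"
  have "f' h = D \<bullet> h" for h
  proof -
    have "f' h = f' (\<Sum>b\<in>Basis. (h \<bullet> b) *\<^sub>R b)"
      by (simp add: euclidean_representation)
    also have "\<dots> = (\<Sum>b\<in>Basis. (h \<bullet> b) * f' b)"
      using has_derivative_linear[OF f'] by (simp add: linear_sum linear_scale)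
    finally show ?thesis
      unfolding D_def by (subst inner_commute) (simp add: inner_sum_right mult.commute)
  qed
  then have "f' = (\<lambda>h. D \<bullet> h)"
    by (rule ext)
  with f' have "(f has_derivative (\<lambda>h. D \<bullet> h)) (at x)"
    by (simp only:)
  then show ?thesis
    by (simp only: gradient_euclidean_eq)
qed

lemma gradient_conformal_eq:
  fixes D :: "'a::real_inner"
  assumes g: "\<And>v w. g x v w = inverse ((F x)\<^sup>2) * (v \<bullet> w)"
    and "F x \<noteq> 0"
    and f: "(f has_derivative (\<lambda>h. D \<bullet> h)) (at x)"
  shows "gradient g f x = (F x)\<^sup>2 *\<^sub>R D"
  unfolding gradient_def
proof (rule the_equality)
  have "g x ((F x)\<^sup>2 *\<^sub>R D) = (\<lambda>h. D \<bullet> h)"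
    using \<open>F x \<noteq> 0\<close> by (auto simp: g)
  then show "(f has_derivative g x ((F x)\<^sup>2 *\<^sub>R D)) (at x)"
    using f by simp
next
  fix E assume "(f has_derivative g x E) (at x)"
  then have "g x E = (\<lambda>h. D \<bullet> h)"
    using f by (rule has_derivative_unique)
  then have "inverse ((F x)\<^sup>2) * (E \<bullet> h) = D \<bullet> h" for h
    by (metis g)
  then have "E \<bullet> h = ((F x)\<^sup>2 *\<^sub>R D) \<bullet> h" for h
    using \<open>F x \<noteq> 0\<close> by (simp add: field_simps)
  then show "E = (F x)\<^sup>2 *\<^sub>R D"
    by (metis vector_eq_rdot)
qed

lemma C2_on_differentiable:
  assumes "C2_on S u" "x \<in> S"
  shows "u differentiable at x"
  using assms unfolding C2_on_def differentiable_def by blast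

lemma C2_on_gradient_euclidean_differentiable:
  fixes u :: "'a::euclidean_space \<Rightarrow> real"
  assumes "C2_on S u" "open S" "x \<in> S"
  shows "gradient euclidean_metric_field u differentiable at x"
proof -
  obtain u' :: "'a \<Rightarrow> 'a \<Rightarrow>\<^sub>L real" and u'' :: "'a \<Rightarrow> 'a \<Rightarrow>\<^sub>L 'a \<Rightarrow>\<^sub>L real"
    where u': "\<And>y. y \<in> S \<Longrightarrow> (u has_derivative blinfun_apply (u' y)) (at y)"
      and u'': "\<And>y. y \<in> S \<Longrightarrow> (u' has_derivative blinfun_apply (u'' y)) (at y)"
    using assms(1) unfolding C2_on_def by blast
  have eq: "(\<Sum>b\<in>Basis. u' y b *\<^sub>R b) = gradient euclidean_metric_field u y" if "y \<in> S" for y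
  proof -
    have "blinfun_apply (u' y) = (\<lambda>h. gradient euclidean_metric_field u y \<bullet> h)"
      using u'[OF that] has_derivative_gradient_euclidean[OF C2_on_differentiable[OF assms(1) that]]
      by (rule has_derivative_unique)
    then show ?thesis
      by (simp add: euclidean_representation)
  qed
  have "((\<lambda>y. \<Sum>b\<in>Basis. u' y b *\<^sub>R b) has_derivative
        (\<lambda>h. \<Sum>b\<in>Basis. u'' x h b *\<^sub>R b)) (at x)"
    by (auto intro!: derivative_eq_intros u''[OF assms(3)])
  then have "(gradient euclidean_metric_field u has_derivative
        (\<lambda>h. \<Sum>b\<in>Basis. u'' x h b *\<^sub>R b)) (at x)"
    using assms(2,3) eq by (rule has_derivative_transform_within_open)
  then show ?thesis
    unfolding differentiable_def by blast
qed

text \<open>The transformation law of the \<open>\<infinity>\<close>-Laplacian under a conformal change of the flat metric;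
  \<open>G\<close> is the Euclidean gradient of the conformal factor at \<open>x\<close>.\<close>

lemma infinity_laplacian_conformal:
  fixes u :: "'a::euclidean_space \<Rightarrow> real"
  assumes g: "\<And>y v w. y \<in> S \<Longrightarrow> g y v w = inverse ((F y)\<^sup>2) * (v \<bullet> w)"
    and F0: "\<And>y. y \<in> S \<Longrightarrow> F y \<noteq> 0"
    and F: "(F has_derivative (\<lambda>h. G \<bullet> h)) (at x)"
    and u: "C2_on S u" and S: "open S" "x \<in> S"
  defines "D \<equiv> gradient euclidean_metric_field u"
  shows "infinity_laplacian g u x =
    F x ^ 4 * infinity_laplacian euclidean_metric_field u x
    + F x ^ 3 * (norm (D x))\<^sup>2 * (G \<bullet> D x)"
proof -
  define P where "P = gradient euclidean_metric_field (\<lambda>y. D y \<bullet> D y) x"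
  have gu: "gradient g u y = (F y)\<^sup>2 *\<^sub>R D y" if "y \<in> S" for y
    unfolding D_def
    using g[OF that] F0[OF that]
      has_derivative_gradient_euclidean[OF C2_on_differentiable[OF u that]]
    by (rule gradient_conformal_eq)
  have sq: "(F y)\<^sup>2 * (D y \<bullet> D y) = g y (gradient g u y) (gradient g u y)" if "y \<in> S" for y
    using F0[OF that] by (simp add: g[OF that] gu[OF that] power2_eq_square field_simps)
  have "D differentiable at x"
    unfolding D_def using u S by (rule C2_on_gradient_euclidean_differentiable)
  then have "(\<lambda>y. D y \<bullet> D y) differentiable at x"
    unfolding differentiable_def by (blast intro: has_derivative_inner)
  then have P: "((\<lambda>y. D y \<bullet> D y) has_derivative (\<lambda>h. P \<bullet> h)) (at x)"
    unfolding P_def by (rule has_derivative_gradient_euclidean)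
  \<comment> \<open>by the product rule, the Euclidean gradient of \<open>F\<^sup>2 \<bar>\<nabla>u\<bar>\<^sup>2\<close> at \<open>x\<close>\<close>
  define Q where "Q = (F x)\<^sup>2 *\<^sub>R P + (2 * F x * (D x \<bullet> D x)) *\<^sub>R G"
  have "((\<lambda>y. (F y)\<^sup>2 * (D y \<bullet> D y)) has_derivative (\<lambda>h. Q \<bullet> h)) (at x)"
    unfolding Q_def
    by (rule derivative_eq_intros F P refl)+ (simp add: fun_eq_iff inner_add_left algebra_simps)
  then have "((\<lambda>y. g y (gradient g u y) (gradient g u y)) has_derivative (\<lambda>h. Q \<bullet> h)) (at x)"
    using S sq by (rule has_derivative_transform_within_open)
  with g[OF S(2)] F0[OF S(2)]
  have "gradient g (\<lambda>y. g y (gradient g u y) (gradient g u y)) x = (F x)\<^sup>2 *\<^sub>R Q"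
    by (rule gradient_conformal_eq)
  then have "infinity_laplacian g u x
      = 1 / 2 * (inverse ((F x)\<^sup>2) * ((F x)\<^sup>2 * ((F x)\<^sup>2 * (D x \<bullet> Q))))"
    unfolding infinity_laplacian_def
    by (simp only: g[OF S(2)] gu[OF S(2)] inner_scaleR_left inner_scaleR_right)
  moreover have "inverse ((F x)\<^sup>2) * ((F x)\<^sup>2 * c) = c" for c
    using F0[OF S(2)] by simp
  ultimately have "infinity_laplacian g u x = 1 / 2 * ((F x)\<^sup>2 * (D x \<bullet> Q))"
    by presburger
  moreover have "infinity_laplacian euclidean_metric_field u x = 1 / 2 * (D x \<bullet> P)"
    unfolding infinity_laplacian_def P_def D_def by (simp add: euclidean_metric_field_def)
  moreover have "D x \<bullet> Q = (F x)\<^sup>2 * (D x \<bullet> P) + 2 * F x * (norm (D x))\<^sup>2 * (G \<bullet> D x)"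
    unfolding Q_def inner_add_right inner_scaleR_right power2_norm_eq_inner
    by (simp only: inner_commute[of "D x" G])
  ultimately show ?thesis
    by (simp add: distrib_left power_eq_if)
qed

lemma hyperbolic_factor_pos:
  assumes "x \<in> ball 0 1"
  shows "hyperbolic_factor x > 0"
  using assms by (simp add: hyperbolic_factor_def power_less_one_iff)

lemma has_derivative_hyperbolic_factor:
  "(hyperbolic_factor has_derivative (\<lambda>h. (- x) \<bullet> h)) (at x)"
proof -
  have "((\<lambda>y. 1 / 2 * (1 - y \<bullet> y)) has_derivative (\<lambda>h. (- x) \<bullet> h)) (at x)"
    by (rule derivative_eq_intros refl)+ (simp add: fun_eq_iff inner_commute)
  then show ?thesis
    by (simp add: hyperbolic_factor_def[abs_def] power2_norm_eq_inner)
qed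

theorem corollary6p4:
  fixes u :: "real ^ 'm \<Rightarrow> real"
  assumes "C2_on (ball 0 1) u"
  shows "(\<forall>x\<in>ball 0 1. infinity_laplacian hyperbolic_metric_field u x = 0) \<longleftrightarrow>
         (\<forall>x\<in>ball 0 1.
            infinity_laplacian euclidean_metric_field u x
            - 2 * (norm (gradient euclidean_metric_field u x))\<^sup>2 / (1 - (norm x)\<^sup>2)
                * (x \<bullet> gradient euclidean_metric_field u x) = 0)"
proof (intro ball_cong refl)
  fix x :: "real ^ 'm"
  assume x: "x \<in> ball 0 1"
  define F where "F = hyperbolic_factor x"
  define D where "D = gradient euclidean_metric_field u x"
  define L where "L = infinity_laplacian euclidean_metric_field u x"
  have "F > 0"
    unfolding F_def using x by (rule hyperbolic_factor_pos)
  have "infinity_laplacian hyperbolic_metric_field u x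
      = F ^ 4 * L + F ^ 3 * (norm D)\<^sup>2 * ((- x) \<bullet> D)"
    unfolding F_def D_def L_def
  proof (rule infinity_laplacian_conformal)
    show "hyperbolic_factor y \<noteq> 0" if "y \<in> ball 0 1" for y :: "real ^ 'm"
      using hyperbolic_factor_pos[OF that] by simp
  qed (use assms x in \<open>auto simp: hyperbolic_metric_field_def
        intro: has_derivative_hyperbolic_factor[simplified]\<close>)
  also have "\<dots> = F ^ 4 * (L - (norm D)\<^sup>2 / F * (x \<bullet> D))"
    using \<open>F > 0\<close> by (simp add: field_simps power3_eq_cube power4_eq_xxxx)
  also have "(norm D)\<^sup>2 / F = 2 * (norm D)\<^sup>2 / (1 - (norm x)\<^sup>2)"
    by (simp add: F_def hyperbolic_factor_def)
  finally show "infinity_laplacian hyperbolic_metric_field u x = 0 \<longleftrightarrow>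
      infinity_laplacian euclidean_metric_field u x
      - 2 * (norm (gradient euclidean_metric_field u x))\<^sup>2 / (1 - (norm x)\<^sup>2)
          * (x \<bullet> gradient euclidean_metric_field u x) = 0"
    using \<open>F > 0\<close> by (simp add: D_def L_def)
qed

end
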